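(* Let $K\subset\mathbb{R}^n$ be a convex body, $n\ge 2$, and let $\Pi$ be a hyperplane tangent to $K$. Suppose there exists a point $p$ in the interior of $K$ such that for every $x\in\Pi\setminus K$ the cone $C_x$ circumscribed to $K$ with apex $x$ is a symmetric cone and its axis $L_x$ passes through $p$. Then $K$ is a ball.
   Context: A convex body in $\mathbb{R}^n$ is a compact convex set with non-empty interior; hyperplanes are affine. The term "tangent" is used for the hyperplane $\Pi$ without any further definition. For $x\in\mathbb{R}^n\setminus K$, the solid cone generated by $K$ and $x$ is $\{x+\lambda(y-x) : y\in K,\ \lambda\ge 0\}$, and the cone $C_x$ circumscribed to $K$ with apex $x$ is the boundary of this solid cone. A convex cone $C$ with apex $x$ is a symmetric cone with axis $L_x$ if $L_x$ is a line through $x$ such that for every $2$-dimensional plane $\Gamma$ containing $L_x$, the line $L_x$ is the angle bisector of the angular region $\Gamma\cap C$. Saying that $C_x$ is a symmetric cone with axis $L_x$ means that the solid cone bounded by $C_x$ is a symmetric cone with axis $L_x$. For $n=2$ every such cone is symmetric, and $L_x$ is the bisector of the angle with vertex $x$ circumscribed to $K$.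
   Formalization: "Tangent" is read as supporting; for n = 2 the line Π is also required to meet K in a single point, since otherwise the convex hull of a disc and a segment of Π around its point of tangency is a counterexample. *)

theory Defs
  imports "HOL-Analysis.Analysis"
begin

definition convex_body :: "'a::euclidean_space set \<Rightarrow> bool" where
  "convex_body K \<longleftrightarrow> compact K \<and> convex K \<and> interior K \<noteq> {}"

definition supporting_hyperplane :: "'a::euclidean_space set \<Rightarrow> 'a set \<Rightarrow> bool" where
  "supporting_hyperplane K H \<longleftrightarrow>
     (\<exists>a b. a \<noteq> 0 \<and> H = {y. a \<bullet> y = b} \<and> K \<subseteq> {y. a \<bullet> y \<le> b} \<and> H \<inter> K \<noteq> {})"

(* Tangency means support. In the plane the contact set is moreover required to be a single
   point: the convex hull of a disc and a segment [a,b] (a < b) that lies on a tangent line of the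
   disc and has the point of tangency in its relative interior is not a disc, but its circumscribed
   angle at every point of that line outside [a,b] is that of the disc. In higher dimensions the
   contact set is unrestricted (it may be a facet, for instance). *)
definition tangent_hyperplane :: "'a::euclidean_space set \<Rightarrow> 'a set \<Rightarrow> bool" where
  "tangent_hyperplane K H \<longleftrightarrow>
     supporting_hyperplane K H \<and> (DIM('a) = 2 \<longrightarrow> (\<exists>q. H \<inter> K = {q}))"

(* The circumscribed cone itself is the frontier of this set; its symmetry is by definition
   a property of the solid cone. *)
definition solid_cone :: "'a::euclidean_space set \<Rightarrow> 'a \<Rightarrow> 'a set" where
  "solid_cone K x = {x + l *\<^sub>R (y - x) | l y. y \<in> K \<and> l \<ge> 0}"

(* A is an angular region with vertex x, of angle strictly between 0 and pi, with sides in the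
   unit directions u and v; its bisector is the line through x in the direction u + v. *)
definition angle_bisector :: "'a::euclidean_space set \<Rightarrow> 'a \<Rightarrow> 'a set \<Rightarrow> bool" where
  "angle_bisector A x L \<longleftrightarrow>
     (\<exists>u v. norm u = 1 \<and> norm v = 1 \<and> u \<noteq> v \<and> u \<noteq> - v \<and>
        A = {x + s *\<^sub>R u + t *\<^sub>R v | s t. s \<ge> 0 \<and> t \<ge> 0} \<and>
        L = {x + t *\<^sub>R (u + v) | t. t \<in> UNIV})"

definition symmetric_cone :: "'a::euclidean_space set \<Rightarrow> 'a \<Rightarrow> 'a set \<Rightarrow> bool" where
  "symmetric_cone C x L \<longleftrightarrow>
     convex_cone ((\<lambda>y. y - x) ` C) \<and>
     affine L \<and> aff_dim L = 1 \<and> x \<in> L \<and>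
     (\<forall>G. affine G \<and> aff_dim G = 2 \<and> L \<subseteq> G \<longrightarrow> angle_bisector (G \<inter> C) x L)"

end

theory Submission
  imports Defs
begin

text \<open>
  Let \<open>h(u)\<close> be the distance from \<open>p\<close> to the support hyperplane of \<open>K\<close> with outer unit normal \<open>u\<close>,
  and let \<open>a\<close> be the outer unit normal of \<open>H\<close>. For \<open>x \<in> H - K\<close> the solid cone is invariant under the
  reflection in the line \<open>xp\<close>; hence this reflection permutes the outer unit normals \<open>u\<close> of the
  support hyperplanes through \<open>x\<close>, and it preserves \<open>h(u)\<close>. It suffices that \<open>h\<close> takes no value other
  than \<open>h(a)\<close> and \<open>h(-a)\<close>: being continuous on a connected sphere, it is then constant.

  In dimension at least 3, let \<open>M\<close> be a level set of \<open>h\<close> that contains neither \<open>a\<close> nor \<open>-a\<close>. The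
  support hyperplane with normal \<open>u \<in> M\<close> meets \<open>H\<close> in an unbounded set. Reflecting \<open>u\<close> at points \<open>x\<close> of
  it gives elements \<open>v\<close> of \<open>M\<close> with \<open>a \<bullet> v > - (a \<bullet> u)\<close>, and \<open>v\<close> tends to \<open>-u\<close> as \<open>x\<close> goes to infinity.
  So \<open>M = -M\<close>, and taking \<open>u \<in> M\<close> with \<open>a \<bullet> u\<close> minimal contradicts \<open>- v \<in> M\<close>.

  If \<open>H\<close> touches \<open>K\<close> in a single point \<open>q\<close>, take for \<open>u \<noteq> -a\<close> the point \<open>x \<in> H\<close> for which the reflection
  maps \<open>a\<close> to \<open>u\<close>. Either \<open>x \<notin> K\<close> and \<open>h(u) = h(a)\<close>, or \<open>x \<in> K\<close> and \<open>h(u) \<ge> h(a)\<close>. Therefore the foot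
  of the perpendicular from \<open>p\<close> to \<open>H\<close> lies in \<open>K\<close>, so it is \<open>q\<close>, and \<open>x = q\<close> only for \<open>u = a\<close>.
\<close>

section \<open>Reflection in a line through the origin\<close>

definition axial_reflection :: "'a::real_inner \<Rightarrow> 'a \<Rightarrow> 'a" where
  "axial_reflection w y = (2 * (w \<bullet> y) / (w \<bullet> w)) *\<^sub>R w - y"

lemma axial_reflection_self: "axial_reflection w w = w"
  by (cases "w = 0") (simp_all add: axial_reflection_def scaleR_2)

lemma axial_reflection_add:
  "axial_reflection w (y + z) = axial_reflection w y + axial_reflection w z"
  by (simp add: axial_reflection_def inner_add_right distrib_left add_divide_distrib
      scaleR_add_left)

lemma axial_reflection_scaleR: "axial_reflection w (k *\<^sub>R y) = k *\<^sub>R axial_reflection w y"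
  by (simp add: axial_reflection_def scaleR_diff_right mult.left_commute)

lemma axial_reflection_scaleR_axis:
  "k \<noteq> 0 \<Longrightarrow> axial_reflection (k *\<^sub>R w) y = axial_reflection w y"
  by (simp add: axial_reflection_def)

lemma inner_axial_reflection_commute:
  "axial_reflection w y \<bullet> z = y \<bullet> axial_reflection w z"
  by (simp add: axial_reflection_def inner_diff_left inner_diff_right inner_commute)

lemma axial_reflection_idem:
  assumes "w \<noteq> 0"
  shows "axial_reflection w (axial_reflection w y) = y"
  using assms by (simp add: axial_reflection_def inner_diff_right)

lemma norm_axial_reflection:
  assumes "w \<noteq> 0"
  shows "norm (axial_reflection w y) = norm y"
  using assms by (simp add: norm_eq_sqrt_inner inner_axial_reflection_commute axial_reflection_idem)

text \<open>For vectors of equal norm,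
  \<open>(u + v) \<bullet> (u + v) = 2 * ((u + v) \<bullet> u)\<close>, so the coefficient in the
  reflection is 1.\<close>

lemma axial_reflection_bisector:
  assumes "norm u = norm v" "u \<noteq> - v"
  shows "axial_reflection (u + v) u = v"
proof -
  have "u \<bullet> u = v \<bullet> v"
    using assms(1) by (simp add: norm_eq_sqrt_inner)
  then have "(u + v) \<bullet> (u + v) = 2 * ((u + v) \<bullet> u)"
    by (simp add: inner_add_left inner_add_right inner_commute)
  moreover have "(u + v) \<bullet> (u + v) \<noteq> 0"
    using assms(2) by (simp add: eq_neg_iff_add_eq_0)
  ultimately have "2 * ((u + v) \<bullet> u) / ((u + v) \<bullet> (u + v)) = 1"
    by simp
  then show ?thesis
    unfolding axial_reflection_def by (simp only: scaleR_one add_diff_cancel_left')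
qed

text \<open>The plane through \<open>y\<close> and the axis cuts the cone in an angular region
  bisected by the axis, and the reflection swaps the two sides of that region.\<close>

lemma symmetric_cone_axial_reflection:
  fixes C :: "'a::euclidean_space set"
  assumes sym: "symmetric_cone C x L" and p: "p \<in> L" "p \<noteq> x" and y: "y \<in> C"
  shows "x + axial_reflection (p - x) (y - x) \<in> C"
proof (cases "y \<in> affine hull {x, p}")
  case True
  then obtain k where "y = x + k *\<^sub>R (p - x)"
    unfolding affine_hull_2_alt by blast
  then have "axial_reflection (p - x) (y - x) = y - x"
    by (simp add: axial_reflection_scaleR axial_reflection_self)
  then show ?thesis
    using y by simp
next
  case False
  define G where "G = affine hull {y, x, p}"
  have L: "affine L" "aff_dim L = 1" "x \<in> L"
    using sym by (auto simp: symmetric_cone_def)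
  have "affine hull {x, p} = L"
    using L p by (intro affine_dim_equal) (auto simp: hull_minimal affine_affine_hull aff_dim_affine_hull)
  then have "L \<subseteq> G"
    unfolding G_def by (metis hull_mono subset_insertI)
  moreover have "aff_dim G = 2"
    using False p unfolding G_def by (simp add: aff_dim_affine_hull aff_dim_insert[of y])
  ultimately have "angle_bisector (G \<inter> C) x L"
    using sym by (simp add: symmetric_cone_def G_def affine_affine_hull)
  then obtain u v where uv: "norm u = 1" "norm v = 1" "u \<noteq> - v"
    and GC: "G \<inter> C = {x + s *\<^sub>R u + t *\<^sub>R v | s t. s \<ge> 0 \<and> t \<ge> 0}"
    and Lbis: "L = {x + t *\<^sub>R (u + v) | t. t \<in> UNIV}"
    unfolding angle_bisector_def by blast
  obtain k where k: "p - x = k *\<^sub>R (u + v)"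
    using p Lbis by auto
  with p have "k \<noteq> 0" by auto
  then have R: "axial_reflection (p - x) = axial_reflection (u + v)"
    by (simp add: k axial_reflection_scaleR_axis fun_eq_iff)
  have "y \<in> G \<inter> C"
    using y by (simp add: G_def hull_inc)
  then obtain s t where st: "s \<ge> 0" "t \<ge> 0" "y - x = s *\<^sub>R u + t *\<^sub>R v"
    unfolding GC by auto
  have "v \<noteq> - u"
    using uv(3) by force
  then have "axial_reflection (u + v) u = v" "axial_reflection (u + v) v = u"
    using uv axial_reflection_bisector[of u v] axial_reflection_bisector[of v u]
    by (simp_all add: add.commute)
  then have "axial_reflection (p - x) (y - x) = s *\<^sub>R v + t *\<^sub>R u"
    by (simp add: R st(3) axial_reflection_add axial_reflection_scaleR)
  then have "x + axial_reflection (p - x) (y - x) = x + t *\<^sub>R u + s *\<^sub>R v"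
    by simp
  then have "x + axial_reflection (p - x) (y - x) \<in> G \<inter> C"
    unfolding GC using st by blast
  then show ?thesis by simp
qed

section \<open>Support functions\<close>

definition support_function :: "'a::real_inner set \<Rightarrow> 'a \<Rightarrow> real" where
  "support_function K u = (SUP y\<in>K. u \<bullet> y)"

lemma inner_le_support_function:
  assumes "compact K" "y \<in> K"
  shows "u \<bullet> y \<le> support_function K u"
proof -
  have "compact ((\<lambda>y. u \<bullet> y) ` K)"
    using assms by (intro compact_continuous_image continuous_intros)
  then have "bdd_above ((\<lambda>y. u \<bullet> y) ` K)"
    by (simp add: bounded_imp_bdd_above compact_imp_bounded)
  then show ?thesis
    unfolding support_function_def using assms by (intro cSUP_upper)
qed

lemma support_function_attained:
  assumes "compact K" "K \<noteq> {}"
  obtains y where "y \<in> K" "support_function K u = u \<bullet> y"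
proof -
  have "continuous_on K (\<lambda>y. u \<bullet> y)"
    by (intro continuous_intros)
  then obtain y where y: "y \<in> K" "\<And>z. z \<in> K \<Longrightarrow> u \<bullet> z \<le> u \<bullet> y"
    using continuous_attains_sup[OF assms] by blast
  then have "support_function K u = u \<bullet> y"
    unfolding support_function_def by (intro cSup_eq_maximum) auto
  with y that show thesis by blast
qed

lemma support_function_eqI:
  assumes "compact K" "y \<in> K" "u \<bullet> y = c" "\<And>z. z \<in> K \<Longrightarrow> u \<bullet> z \<le> c"
  shows "support_function K u = c"
  using assms by (metis antisym empty_iff inner_le_support_function support_function_attained)

text \<open>Compare both functions at a point of \<open>K\<close> maximal in direction
  \<open>u\<close>. Exchanging \<open>u\<close> and \<open>v\<close> gives Lipschitz
  continuity.\<close>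

lemma support_function_diff_le:
  assumes "compact K" "K \<noteq> {}" "\<And>y. y \<in> K \<Longrightarrow> norm y \<le> B"
  shows "support_function K u - support_function K v \<le> B * norm (u - v)"
proof -
  obtain y where y: "y \<in> K" "support_function K u = u \<bullet> y"
    using support_function_attained[OF assms(1,2)] .
  have "support_function K u - support_function K v \<le> (u - v) \<bullet> y"
    using inner_le_support_function[OF assms(1) y(1), of v] y(2) by (simp add: inner_diff_left)
  also have "\<dots> \<le> norm (u - v) * norm y"
    by (rule norm_cauchy_schwarz)
  also have "\<dots> \<le> norm (u - v) * B"
    using assms(3) y(1) by (intro mult_left_mono) auto
  finally show ?thesis by (simp add: mult.commute)
qed

lemma continuous_on_support_function:
  fixes K :: "'a::euclidean_space set"
  assumes "compact K" "K \<noteq> {}"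
  shows "continuous_on S (support_function K)"
proof -
  obtain B where B: "B > 0" "\<And>y. y \<in> K \<Longrightarrow> norm y \<le> B"
    using assms(1) by (metis bounded_pos compact_imp_bounded)
  have "B-lipschitz_on S (support_function K)"
  proof (rule lipschitz_onI)
    fix u v
    show "dist (support_function K u) (support_function K v) \<le> B * dist u v"
      using support_function_diff_le[OF assms B(2), of u v]
        support_function_diff_le[OF assms B(2), of v u]
      by (auto simp: dist_norm norm_minus_commute)
  qed (use B in simp)
  then show ?thesis
    by (rule lipschitz_on_continuous_on)
qed

lemma mem_if_support_function:
  fixes K :: "'a::euclidean_space set"
  assumes "compact K" "convex K" "K \<noteq> {}"
    and "\<And>u. norm u = 1 \<Longrightarrow> u \<bullet> z \<le> support_function K u"
  shows "z \<in> K"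
proof (rule ccontr)
  assume "z \<notin> K"
  then obtain d b where d: "d \<bullet> z < b" "\<And>y. y \<in> K \<Longrightarrow> b < d \<bullet> y"
    using separating_hyperplane_closed_point[OF assms(2) compact_imp_closed[OF assms(1)]] by blast
  \<comment> \<open>Separation places \<open>K\<close> where \<open>d\<close> is large, so the
    normal pointing from \<open>K\<close> towards \<open>z\<close> is along
    \<open>- d\<close>.\<close>
  define u where "u = (- 1 / norm d) *\<^sub>R d"
  have "d \<noteq> 0"
    using d assms(3) by fastforce
  then have "norm u = 1"
    by (simp add: u_def)
  obtain y where y: "y \<in> K" "support_function K u = u \<bullet> y"
    using support_function_attained[OF assms(1,3)] .
  have "d \<bullet> z < d \<bullet> y"
    using d y(1) by fastforce
  then have "u \<bullet> y < u \<bullet> z"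
    using \<open>d \<noteq> 0\<close> by (simp add: u_def divide_strict_right_mono)
  then show False
    using assms(4)[OF \<open>norm u = 1\<close>] y(2) by simp
qed

lemma eq_cball_if_support_function:
  fixes K :: "'a::euclidean_space set"
  assumes "compact K" "convex K" "K \<noteq> {}" "r > 0"
    and h: "\<And>u. norm u = 1 \<Longrightarrow> support_function K u = u \<bullet> p + r"
  shows "K = cball p r"
proof (intro set_eqI iffI)
  fix z assume "z \<in> K"
  show "z \<in> cball p r"
  proof (cases "z = p")
    case False
    define u where "u = (1 / norm (z - p)) *\<^sub>R (z - p)"
    have "norm u = 1"
      using False by (simp add: u_def)
    then have "u \<bullet> (z - p) \<le> r"
      using h inner_le_support_function[OF assms(1) \<open>z \<in> K\<close>, of u] by (simp add: inner_diff_right)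
    moreover have "u \<bullet> (z - p) = norm (z - p)"
      using False by (simp add: u_def dot_square_norm power2_eq_square)
    ultimately show ?thesis
      by (simp add: dist_norm norm_minus_commute)
  qed (use assms in simp)
next
  fix z assume z: "z \<in> cball p r"
  show "z \<in> K"
  proof (rule mem_if_support_function[OF assms(1-3)])
    fix u :: 'a assume u: "norm u = 1"
    have "u \<bullet> (z - p) \<le> norm (z - p)"
      using norm_cauchy_schwarz[of u "z - p"] u by simp
    also have "\<dots> \<le> r"
      using z by (simp add: dist_norm norm_minus_commute)
    finally show "u \<bullet> z \<le> support_function K u"
      using h[OF u] by (simp add: inner_diff_right)
  qed
qed

lemma inner_less_support_function_interior:
  fixes K :: "'a::euclidean_space set"
  assumes "compact K" "p \<in> interior K" "norm u = 1"
  shows "u \<bullet> p < support_function K u"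
proof -
  obtain e where e: "e > 0" "cball p e \<subseteq> K"
    using assms(2) by (auto simp: mem_interior_cball)
  have "p + e *\<^sub>R u \<in> K"
    using e assms(3) by (intro subsetD[OF e(2)]) (simp add: dist_norm)
  from inner_le_support_function[OF assms(1) this, of u] show ?thesis
    using e assms(3) by (simp add: inner_add_right dot_square_norm)
qed

text \<open>The reflection is self-adjoint and preserves the solid cone, so the sign condition that
  makes \<open>u\<close> an outer normal at \<open>x\<close> passes to \<open>v\<close>.\<close>

lemma support_function_axial_reflection:
  fixes K :: "'a::euclidean_space set"
  assumes K: "compact K" "K \<noteq> {}" and x: "x \<notin> K"
    and sym: "symmetric_cone (solid_cone K x) x L" and p: "p \<in> L" "p \<noteq> x"
    and u: "support_function K u = u \<bullet> x"
  defines "v \<equiv> axial_reflection (p - x) u"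
  shows "support_function K v = v \<bullet> x"
proof -
  have refl: "\<exists>l y'. y' \<in> K \<and> l \<ge> 0 \<and> axial_reflection (p - x) (y - x) = l *\<^sub>R (y' - x)"
    if y: "y \<in> K" for y
  proof -
    have "y = x + 1 *\<^sub>R (y - x)" by simp
    with y have "y \<in> solid_cone K x"
      unfolding solid_cone_def by (metis (mono_tags, lifting) mem_Collect_eq zero_le_one)
    from symmetric_cone_axial_reflection[OF sym p this] show ?thesis
      unfolding solid_cone_def by auto
  qed
  have le: "v \<bullet> (y - x) \<le> 0" if y: "y \<in> K" for y
  proof -
    obtain l y' where y': "y' \<in> K" "l \<ge> 0" "axial_reflection (p - x) (y - x) = l *\<^sub>R (y' - x)"
      using refl[OF y] by blast
    have "v \<bullet> (y - x) = l * (u \<bullet> (y' - x))"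
      by (simp add: v_def inner_axial_reflection_commute y'(3))
    moreover have "u \<bullet> (y' - x) \<le> 0"
      using inner_le_support_function[OF K(1) y'(1), of u] u by (simp add: inner_diff_right)
    ultimately show ?thesis
      using y'(2) by (simp add: mult_nonneg_nonpos)
  qed
  obtain y where y: "y \<in> K" "support_function K u = u \<bullet> y"
    using support_function_attained[OF K] .
  obtain l y' where y': "y' \<in> K" "l \<ge> 0" "axial_reflection (p - x) (y - x) = l *\<^sub>R (y' - x)"
    using refl[OF y(1)] by blast
  \<comment> \<open>Since \<open>y \<noteq> x\<close>, the reflected ray is nondegenerate, and its
    point \<open>y'\<close> of \<open>K\<close> is a contact point for \<open>v\<close>.\<close>
  have "norm (axial_reflection (p - x) (y - x)) = norm (y - x)"
    using p by (intro norm_axial_reflection) simp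
  with y(1) x have "l \<noteq> 0"
    using y'(3) by auto
  have "l * (v \<bullet> (y' - x)) = v \<bullet> axial_reflection (p - x) (y - x)"
    by (simp add: y'(3))
  also have "\<dots> = u \<bullet> (y - x)"
    using p by (simp add: v_def inner_axial_reflection_commute axial_reflection_idem)
  also have "\<dots> = 0"
    using y(2) u by (simp add: inner_diff_right)
  finally have "v \<bullet> (y' - x) = 0"
    using \<open>l \<noteq> 0\<close> by simp
  then show ?thesis
    using le by (intro support_function_eqI[OF K(1) y'(1)]) (auto simp: inner_diff_right)
qed

lemma abs_inner_less_1:
  fixes a u :: "'a::real_inner"
  assumes "norm a = 1" "norm u = 1" "u \<noteq> a" "u \<noteq> - a"
  shows "\<bar>a \<bullet> u\<bar> < 1"
proof -
  have "\<bar>a \<bullet> u\<bar> \<le> 1"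
    using Cauchy_Schwarz_ineq2[of a u] assms by simp
  moreover have "\<bar>a \<bullet> u\<bar> \<noteq> 1"
    using norm_cauchy_schwarz_abs_eq[of a u] assms
    by (auto simp: minus_equation_iff)
  ultimately show ?thesis by simp
qed

text \<open>From dimension 3 on, some unit vector \<open>d\<close> is orthogonal to both normals;
  moving along it keeps both equations and leaves every ball.\<close>

lemma unbounded_intersection:
  fixes a v :: "'a::euclidean_space"
  assumes dim: "DIM('a) \<ge> 3" and a: "norm a = 1" and v: "norm v = 1" "v \<noteq> a" "v \<noteq> - a"
  obtains w where "a \<bullet> w = r" "v \<bullet> w = c" "norm w > B"
proof -
  have "dim {a, v} \<le> card {a, v}"
    by (rule dim_le_card') simp
  also have "\<dots> \<le> 2"
    by (simp add: card_insert_if)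
  finally obtain d0 where d0: "d0 \<noteq> 0" "\<And>y. y \<in> span {a, v} \<Longrightarrow> orthogonal d0 y"
    using orthogonal_to_subspace_exists[of "{a, v}"] dim
    by (metis le_trans not_le not_less_eq_eq numeral_2_eq_2 numeral_3_eq_3)
  define d where "d = (1 / norm d0) *\<^sub>R d0"
  have d: "a \<bullet> d = 0" "v \<bullet> d = 0" "norm d = 1"
    using d0(1) d0(2)[of a] d0(2)[of v]
    by (simp_all add: d_def orthogonal_def span_base inner_commute)
  define k where "k = a \<bullet> v"
  have "k\<^sup>2 < 1"
    using abs_inner_less_1[OF a v] by (simp add: k_def abs_square_less_1)
  then have k: "1 - k\<^sup>2 \<noteq> 0" by simp
  \<comment> \<open>Cramer's rule for the Gram matrix of \<open>a\<close> and \<open>v\<close>,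
    whose determinant is \<open>1 - k\<^sup>2\<close>.\<close>
  define w0 where "w0 = ((r - k * c) / (1 - k\<^sup>2)) *\<^sub>R a + ((c - k * r) / (1 - k\<^sup>2)) *\<^sub>R v"
  define w where "w = w0 + (\<bar>B\<bar> + 1) *\<^sub>R d"
  have "a \<bullet> w0 = (r - k * c) / (1 - k\<^sup>2) + (c - k * r) / (1 - k\<^sup>2) * k"
    using a by (simp add: w0_def inner_add_right dot_square_norm k_def)
  also have "\<dots> = (r * (1 - k\<^sup>2)) / (1 - k\<^sup>2)"
    by (simp add: add_divide_distrib[symmetric] power2_eq_square algebra_simps)
  finally have "a \<bullet> w = r"
    using k d by (simp add: w_def inner_add_right)
  moreover have "v \<bullet> w0 = (r - k * c) / (1 - k\<^sup>2) * k + (c - k * r) / (1 - k\<^sup>2)"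
    using v by (simp add: w0_def inner_add_right dot_square_norm k_def inner_commute)
  then have "v \<bullet> w0 = (c * (1 - k\<^sup>2)) / (1 - k\<^sup>2)"
    by (simp add: add_divide_distrib[symmetric] power2_eq_square algebra_simps)
  then have "v \<bullet> w = c"
    using k d by (simp add: w_def inner_add_right)
  moreover have "d \<bullet> w = \<bar>B\<bar> + 1"
    using d by (simp add: w_def w0_def inner_add_right dot_square_norm inner_commute)
  then have "norm w > B"
    using norm_cauchy_schwarz[of d w] d(3) by simp
  ultimately show thesis
    using that by blast
qed

text \<open>Keeps of the cone hypothesis only its effect on support hyperplanes through
  \<open>x\<close>. The axis vector \<open>x - p\<close> is the \<open>w\<close> of the lemmas
  below.\<close>

locale symmetric_on_tangent =
  fixes K :: "'a::euclidean_space set" and p a :: 'a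
  assumes compact_K: "compact K" and p: "p \<in> interior K" and norm_a: "norm a = 1"
    and sym: "\<And>x u. a \<bullet> x = support_function K a \<Longrightarrow> x \<notin> K \<Longrightarrow> support_function K u = u \<bullet> x \<Longrightarrow>
      support_function K (axial_reflection (x - p) u) = axial_reflection (x - p) u \<bullet> x"
begin

definition h :: "'a \<Rightarrow> real" where
  "h u = support_function K u - u \<bullet> p"

lemma K_ne: "K \<noteq> {}"
  using p interior_subset by blast

lemma h_pos: "norm u = 1 \<Longrightarrow> h u > 0"
  using inner_less_support_function_interior[OF compact_K p] by (simp add: h_def)

lemma continuous_on_h: "continuous_on S h"
  unfolding h_def
  by (intro continuous_intros continuous_on_support_function[OF compact_K K_ne])

lemma inner_le_h: "p + w \<in> K \<Longrightarrow> u \<bullet> w \<le> h u"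
  using inner_le_support_function[OF compact_K, of "p + w" u] by (simp add: h_def inner_add_right)

text \<open>A self-adjoint reflection fixing \<open>w\<close> preserves the inner product with
  \<open>w\<close>, which is the value of \<open>h\<close> for support hyperplanes through
  \<open>p + w\<close>.\<close>

lemma h_axial_reflection:
  assumes "a \<bullet> w = h a" "p + w \<notin> K" "u \<bullet> w = h u"
  shows "h (axial_reflection w u) = h u"
proof -
  have "w \<noteq> 0"
    using assms(1) h_pos[OF norm_a] by auto
  have "support_function K (axial_reflection w u) = axial_reflection w u \<bullet> (p + w)"
    using sym[of "p + w" u] assms by (simp add: h_def inner_add_right)
  then have "h (axial_reflection w u) = axial_reflection w u \<bullet> w"
    by (simp add: h_def inner_add_right)
  also have "\<dots> = u \<bullet> w"
    by (simp add: inner_axial_reflection_commute axial_reflection_self)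
  finally show ?thesis
    using assms(3) by simp
qed

lemma h_eq_or_eq_antipode_higher_dim:
  assumes dim: "DIM('a) \<ge> 3" and u: "norm u = 1"
  shows "h u = h a \<or> h u = h (- a)"
proof (rule ccontr)
  assume contr: "\<not> (h u = h a \<or> h u = h (- a))"
  define M where "M = {v \<in> sphere 0 1. h v = h u}"
  have M_ne_a: "v \<noteq> a" "v \<noteq> - a" if "v \<in> M" for v
    using that contr by (auto simp: M_def)
  have reflect: "\<exists>v'\<in>M. norm (v' + v) < e \<and> a \<bullet> v' > - (a \<bullet> v)" if v: "v \<in> M" and "e > 0" for v e
  proof -
    have nv: "norm v = 1" using v by (simp add: M_def)
    obtain B where B: "\<And>x. x \<in> K \<Longrightarrow> norm x \<le> B"
      using compact_imp_bounded[OF compact_K] by (auto simp: bounded_iff)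
    \<comment> \<open>The first bound puts \<open>p + w\<close> outside \<open>K\<close>; the second
      makes \<open>v' + v\<close> small.\<close>
    obtain w where w: "a \<bullet> w = h a" "v \<bullet> w = h v" "norm w > max (B + norm p) (2 * h v / e)"
      using unbounded_intersection[OF dim norm_a nv] M_ne_a[OF v] by metis
    have "p + w \<notin> K"
    proof
      assume "p + w \<in> K"
      from B[OF this] show False
        using w(3) norm_triangle_ineq4[of "p + w" p] by simp
    qed
    have "h v > 0" "h a > 0" using h_pos nv norm_a by auto
    have w_pos: "norm w > 0"
      using w(1) \<open>h a > 0\<close> by auto
    \<comment> \<open>\<open>v' + v\<close> is a positive multiple of \<open>w\<close>, of norm
      \<open>2 * h v / norm w\<close>.\<close>
    define v' where "v' = axial_reflection w v"
    have "h v' = h v"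
      unfolding v'_def using w \<open>p + w \<notin> K\<close> by (intro h_axial_reflection)
    moreover have "norm v' = 1"
      using w_pos nv by (simp add: v'_def norm_axial_reflection)
    ultimately have "v' \<in> M"
      using v by (simp add: M_def)
    moreover have "norm (v' + v) < e"
    proof -
      have "norm (v' + v) = 2 * h v / norm w"
        using w(2) \<open>h v > 0\<close> w_pos
        by (simp add: v'_def axial_reflection_def inner_commute dot_square_norm power2_eq_square)
      also have "\<dots> < e"
        using w(3) \<open>e > 0\<close> w_pos by (simp add: field_simps)
      finally show ?thesis .
    qed
    moreover have "a \<bullet> v' > - (a \<bullet> v)"
    proof -
      have "a \<bullet> v' = 2 * h v / (norm w)\<^sup>2 * h a - a \<bullet> v"
        using w by (simp add: v'_def axial_reflection_def inner_commute dot_square_norm inner_diff_right)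
      moreover have "2 * h v / (norm w)\<^sup>2 * h a > 0"
        using \<open>h v > 0\<close> \<open>h a > 0\<close> w_pos by simp
      ultimately show ?thesis by simp
    qed
    ultimately show ?thesis by blast
  qed
  have "compact M"
  proof -
    have "compact (sphere 0 1 \<inter> h -` {h u})"
      by (intro compact_Int_closed compact_sphere continuous_closed_vimage closed_singleton)
        (use continuous_on_h continuous_on_eq_continuous_at open_UNIV in blast)
    moreover have "M = sphere 0 1 \<inter> h -` {h u}"
      by (auto simp: M_def)
    ultimately show ?thesis by simp
  qed
  have neg: "- v \<in> M" if "v \<in> M" for v
  proof -
    have "- v \<in> closure M"
      unfolding closure_approachable using reflect[OF that] by (auto simp: dist_norm)
    then show ?thesis
      using \<open>compact M\<close> by (simp add: compact_imp_closed)
  qed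
  have "M \<noteq> {}"
    using u by (auto simp: M_def)
  then obtain v where v: "v \<in> M" "\<And>v'. v' \<in> M \<Longrightarrow> a \<bullet> v \<le> a \<bullet> v'"
    using continuous_attains_inf[OF \<open>compact M\<close> _ continuous_on_inner[OF continuous_on_const continuous_on_id]]
    by blast
  \<comment> \<open>By symmetry \<open>- v'\<close> lies in \<open>M\<close>, and
    \<open>a \<bullet> (- v') < a \<bullet> v\<close> contradicts minimality.\<close>
  obtain v' where "v' \<in> M" "a \<bullet> v' > - (a \<bullet> v)"
    using reflect[OF v(1) zero_less_one] by blast
  with v(2)[OF neg[of v']] show False by simp
qed

text \<open>Excludes \<open>- a\<close>: a reflection taking \<open>a\<close> to \<open>- a\<close>
  has its axis orthogonal to \<open>a\<close>, so the axis through \<open>p\<close> misses the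
  tangent hyperplane.\<close>

lemma h_eq_away_from_contact_point:
  assumes "convex K" and q: "{x \<in> K. a \<bullet> x = support_function K a} = {q}"
    and u: "norm u = 1" "u \<noteq> - a"
  shows "h u = h a"
proof -
  \<comment> \<open>The bisector direction \<open>a + u\<close>, scaled so that
    \<open>p + w u\<close> lies on the tangent hyperplane; as \<open>a\<close> and \<open>u\<close>
    are unit vectors, also \<open>u \<bullet> w u = h a\<close>.\<close>
  define w where "w u = (h a / (1 + a \<bullet> u)) *\<^sub>R (a + u)" for u
  have inner_w: "a \<bullet> w u = h a" "u \<bullet> w u = h a" and w_eq: "p + w u \<notin> K \<Longrightarrow> h u = h a"
    if u: "norm u = 1" "u \<noteq> - a" for u
  proof -
    have "a \<bullet> u \<noteq> - 1"
      using norm_cauchy_schwarz_abs_eq[of a u] abs_inner_less_1[OF norm_a u(1) _ u(2)] norm_a u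
      by (cases "u = a") (auto simp: dot_square_norm)
    then have "1 + a \<bullet> u \<noteq> 0" by simp
    with norm_a u show *: "a \<bullet> w u = h a" "u \<bullet> w u = h a"
      by (simp_all add: w_def inner_add_right dot_square_norm inner_commute add.commute)
    assume "p + w u \<notin> K"
    then have "h (axial_reflection (w u) a) = h a"
      using * by (intro h_axial_reflection)
    moreover have "axial_reflection (w u) a = u"
      using \<open>1 + a \<bullet> u \<noteq> 0\<close> h_pos[OF norm_a] norm_a u
      by (simp add: w_def axial_reflection_scaleR_axis axial_reflection_bisector
          minus_equation_iff[of u] eq_commute[of a])
    ultimately show "h u = h a" by simp
  qed
  have ge: "h a \<le> h u" if u: "norm u = 1" "u \<noteq> - a" for u
    using w_eq[OF u] inner_le_h[of "w u" u] inner_w[OF u] by fastforce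
  have "p + h a *\<^sub>R a \<in> K"
  proof (rule mem_if_support_function[OF compact_K assms(1) K_ne])
    fix u :: 'a assume u: "norm u = 1"
    have "h a * (u \<bullet> a) \<le> h u"
    \<comment> \<open>\<open>ge\<close> leaves out \<open>- a\<close>, where the left-hand side is
      negative.\<close>
    proof (cases "u = - a")
      case True
      then show ?thesis
        using h_pos[OF u] h_pos[OF norm_a] norm_a by (simp add: dot_square_norm)
    next
      case False
      have "u \<bullet> a \<le> 1"
        using norm_cauchy_schwarz[of u a] u norm_a by simp
      then have "h a * (u \<bullet> a) \<le> h a"
        using h_pos[OF norm_a] by (simp add: mult_left_le)
      with ge[OF u False] show ?thesis by simp
    qed
    then show "u \<bullet> (p + h a *\<^sub>R a) \<le> support_function K u"
      by (simp add: h_def inner_add_right)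
  qed
  moreover have "a \<bullet> (p + h a *\<^sub>R a) = support_function K a"
    using norm_a by (simp add: h_def inner_add_right dot_square_norm)
  ultimately have foot: "p + h a *\<^sub>R a = q"
    using q by blast
  show ?thesis
  proof (cases "p + w u \<in> K")
    \<comment> \<open>Now \<open>p + w u\<close> must be the unique contact point \<open>q\<close>,
      the foot of the perpendicular, and this forces \<open>u = a\<close>.\<close>
    case True
    moreover have "a \<bullet> (p + w u) = support_function K a"
      using inner_w(1)[OF u] by (simp add: h_def inner_add_right)
    ultimately have "w u = h a *\<^sub>R a"
      using q foot by (metis (mono_tags, lifting) add_left_cancel mem_Collect_eq singletonD)
    then have "h a * (u \<bullet> a) = h a"
      using inner_w(2)[OF u] by simp
    then have "a \<bullet> u = 1"
      using h_pos[OF norm_a] by (simp add: inner_commute)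
    then have "u = a"
      using abs_inner_less_1[OF norm_a u(1) _ u(2)] by force
    then show ?thesis by simp
  qed (use w_eq[OF u] in simp)
qed

text \<open>A connected finite set of reals has at most one point, so \<open>h\<close> is constant
  on the sphere, which is connected from dimension 2 on.\<close>

lemma eq_cball:
  assumes "DIM('a) \<ge> 2" "convex K"
    and "\<And>u. norm u = 1 \<Longrightarrow> h u = h a \<or> h u = h (- a)"
  shows "K = cball p (h a)"
proof -
  have "connected (h ` sphere 0 1)"
    using assms(1) by (intro connected_continuous_image continuous_on_h) (simp add: connected_sphere_eq)
  moreover have "finite (h ` sphere 0 1)"
    by (rule finite_subset[of _ "{h a, h (- a)}"]) (use assms(3) in force, simp)
  ultimately obtain c where c: "h ` sphere 0 1 \<subseteq> {c}"
    by (auto simp: connected_finite_iff_sing)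
  have "h u = h a" if "norm u = 1" for u
    using c that norm_a by (auto simp: image_subset_iff)
  then have "support_function K u = u \<bullet> p + h a" if "norm u = 1" for u
    using that by (simp add: h_def algebra_simps)
  then show ?thesis
    by (intro eq_cball_if_support_function compact_K assms K_ne h_pos norm_a)
qed

end

theorem theorem4:
  fixes K H :: "'a::euclidean_space set" and p :: 'a
  assumes "DIM('a) \<ge> 2"
    and "convex_body K"
    and "tangent_hyperplane K H"
    and "p \<in> interior K"
    and "\<forall>x \<in> H - K. \<exists>L. symmetric_cone (solid_cone K x) x L \<and> p \<in> L"
  shows "\<exists>c r. r > 0 \<and> K = cball c r"
proof -
  have K: "compact K" "convex K"
    using assms(2) by (auto simp: convex_body_def)
  obtain d b where d: "d \<noteq> 0" "H = {y. d \<bullet> y = b}" "K \<subseteq> {y. d \<bullet> y \<le> b}" "H \<inter> K \<noteq> {}"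
    using assms(3) unfolding tangent_hyperplane_def supporting_hyperplane_def by blast
  define a where "a = (1 / norm d) *\<^sub>R d"
  obtain y where y: "y \<in> K" "d \<bullet> y = b"
    using d by blast
  have "norm a = 1"
    using d(1) by (simp add: a_def)
  have supp_a: "support_function K a = b / norm d"
    using d y by (intro support_function_eqI[OF K(1) y(1)]) (auto simp: a_def divide_right_mono)
  have H: "H = {x. a \<bullet> x = support_function K a}"
    unfolding d(2) supp_a using d(1) by (simp add: a_def)
  interpret symmetric_on_tangent K p a
  proof
    fix x u
    assume x: "a \<bullet> x = support_function K a" "x \<notin> K" and u: "support_function K u = u \<bullet> x"
    then obtain L where L: "symmetric_cone (solid_cone K x) x L" "p \<in> L"
      using assms(5) H by blast
    have "p \<noteq> x"
      using x(2) assms(4) interior_subset by blast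
    \<comment> \<open>The reflection depends on the line only, so the axis vector may be
      negated.\<close>
    have "axial_reflection (x - p) u = axial_reflection (p - x) u"
      using axial_reflection_scaleR_axis[of "- 1" "p - x" u] by simp
    then show "support_function K (axial_reflection (x - p) u) = axial_reflection (x - p) u \<bullet> x"
      using support_function_axial_reflection[OF K(1) _ x(2) L \<open>p \<noteq> x\<close> u] y(1) by auto
  qed (use K assms \<open>norm a = 1\<close> in auto)
  \<comment> \<open>In the plane tangency supplies the single contact point; from dimension 3 on the
    level-set argument takes over, whatever the contact set.\<close>
  have "h u = h a \<or> h u = h (- a)" if "norm u = 1" for u
  proof (cases "DIM('a) = 2")
    case True
    then obtain q where "H \<inter> K = {q}"
      using assms(3) by (auto simp: tangent_hyperplane_def)
    then have "{x \<in> K. a \<bullet> x = support_function K a} = {q}"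
      by (auto simp: H)
    then show ?thesis
      using h_eq_away_from_contact_point[OF K(2)] that by blast
  next
    case False
    then show ?thesis
      using h_eq_or_eq_antipode_higher_dim[OF _ that] assms(1) by linarith
  qed
  then have "K = cball p (h a)"
    by (rule eq_cball[OF assms(1) K(2)])
  then show ?thesis
    using h_pos[OF norm_a] by blast
qed

end
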